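(* Let $2\leq X\leq T$ and $U\geq X$. Then \[ \sum_{0<\gamma_X\leq T}(\beta_X+U)=U\frac{T}{2\pi}\log X+O(UX)+O(T), \] where the sum runs over the zeros $\rho_X=\beta_X+i\gamma_X$ of $F_X(s)=\sum_{n\leq X}n^{-s}$ with $0<\gamma_X\leq T$, counted with multiplicity, and the implied constants are absolute.
   Context: $s=\sigma+it$, $X$ real, $F_X(s)=\sum_{n\leq X}n^{-s}$ is the partial sum of the Riemann zeta-function; zeros are written $\rho_X=\beta_X+i\gamma_X$.
   Formalization: The main term is proved with log⌊X⌋ in place of log X (the same for integer X); for real X the printed form fails, since F_2 = F_{5/2} while with U = T the two main terms differ by T² log(5/4)/(2π), which is not O(T). *)

theory Defs
  imports "HOL-Complex_Analysis.Complex_Analysis"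
begin

definition zeta_partial_sum :: "real \<Rightarrow> complex \<Rightarrow> complex" where
  "zeta_partial_sum X s = (\<Sum>n | 1 \<le> n \<and> real n \<le> X. of_nat n powr (- s))"

definition zeta_partial_sum_zeros :: "real \<Rightarrow> real \<Rightarrow> complex set" where
  "zeta_partial_sum_zeros X T = {\<rho>. zeta_partial_sum X \<rho> = 0 \<and> 0 < Im \<rho> \<and> Im \<rho> \<le> T}"

text \<open>
  Sums over \<^const>\<open>zeta_partial_sum_zeros\<close> are genuine finite sums: \<^term>\<open>zeta_partial_sum X\<close>
  is dominated by a single term far to the left and far to the right, so its zeros lie in a
  vertical strip.
\<close>

lemma finite_zeta_index: "finite {n. 1 \<le> n \<and> real n \<le> X}"
proof (rule finite_subset)
  show "{n. 1 \<le> n \<and> real n \<le> X} \<subseteq> {..nat \<lfloor>X\<rfloor>}"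
    by (auto simp: le_nat_floor)
qed simp

lemma zeta_partial_sum_zero_dominated:
  assumes "zeta_partial_sum X s = 0" "1 \<le> m" "real m \<le> X"
  shows "1 \<le> (\<Sum>n\<in>{n. 1 \<le> n \<and> real n \<le> X} - {m}. (real n / real m) powr (- Re s))"
proof -
  let ?I = "{n. 1 \<le> n \<and> real n \<le> X}"
  have nrm: "norm (of_nat n powr (- s) :: complex) = real n powr (- Re s)" for n
    by (cases "n = 0") (simp_all add: norm_powr_real_powr)
  have "(of_nat m powr (- s) :: complex) + (\<Sum>n\<in>?I - {m}. of_nat n powr (- s)) = 0"
    using assms sum.remove[OF finite_zeta_index, of m X "\<lambda>n. of_nat n powr (- s) :: complex"]
    by (simp add: zeta_partial_sum_def)
  hence "(of_nat m powr (- s) :: complex) = - (\<Sum>n\<in>?I - {m}. of_nat n powr (- s))"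
    by (simp add: eq_neg_iff_add_eq_0)
  hence "norm (of_nat m powr (- s) :: complex) = norm (\<Sum>n\<in>?I - {m}. (of_nat n powr (- s) :: complex))"
    by simp
  also have "\<dots> \<le> (\<Sum>n\<in>?I - {m}. norm (of_nat n powr (- s) :: complex))"
    by (rule norm_sum)
  finally have "real m powr (- Re s) \<le> (\<Sum>n\<in>?I - {m}. real n powr (- Re s))"
    by (simp only: nrm)
  moreover have "real m powr (- Re s) > 0" using assms by simp
  ultimately have "1 \<le> (\<Sum>n\<in>?I - {m}. real n powr (- Re s)) / real m powr (- Re s)"
    by (simp add: field_simps)
  also have "\<dots> = (\<Sum>n\<in>?I - {m}. (real n / real m) powr (- Re s))"
    unfolding sum_divide_distrib by (intro sum.cong refl) (simp add: powr_divide)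
  finally show ?thesis .
qed

lemma tendsto_powr_at_top_0:
  assumes "0 < c" "c < (1::real)"
  shows "((\<lambda>a. c powr a) \<longlongrightarrow> 0) at_top"
proof -
  have "filterlim (\<lambda>a. ln c * a) at_bot at_top"
    using assms by (intro filterlim_tendsto_neg_mult_at_bot[OF tendsto_const] filterlim_ident) auto
  hence "((\<lambda>a. exp (ln c * a)) \<longlongrightarrow> 0) at_top"
    by (rule filterlim_compose[OF exp_at_bot])
  thus ?thesis using assms by (simp add: powr_def mult.commute)
qed

lemma zeta_partial_sum_zeros_strip:
  assumes "1 \<le> X"
  obtains A where "\<And>s. zeta_partial_sum X s = 0 \<Longrightarrow> \<bar>Re s\<bar> \<le> A"
proof -
  let ?I = "{n. 1 \<le> n \<and> real n \<le> X}"
  define N where "N = nat \<lfloor>X\<rfloor>"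
  have N: "1 \<le> N" "real N \<le> X" using assms by (auto simp: N_def le_nat_floor)
  have le_N: "n \<le> N" if "n \<in> ?I" for n using that by (auto simp: N_def le_nat_floor)
  have "((\<lambda>a. \<Sum>n\<in>?I - {N}. (real n / real N) powr a) \<longlongrightarrow> (\<Sum>n\<in>?I - {N}. 0)) at_top"
    using le_N N by (intro tendsto_sum tendsto_powr_at_top_0) (force simp: field_simps)+
  hence "\<forall>\<^sub>F a in at_top. (\<Sum>n\<in>?I - {N}. (real n / real N) powr a) < 1"
    by (auto dest: order_tendstoD(2)[of _ _ _ 1])
  then obtain a where a: "\<And>x. x \<ge> a \<Longrightarrow> (\<Sum>n\<in>?I - {N}. (real n / real N) powr x) < 1"
    by (auto simp: eventually_at_top_linorder)
  have "((\<lambda>a. \<Sum>n\<in>?I - {1}. (1 / real n) powr a) \<longlongrightarrow> (\<Sum>n\<in>?I - {1}. 0)) at_top"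
    by (intro tendsto_sum tendsto_powr_at_top_0) auto
  hence "\<forall>\<^sub>F a in at_top. (\<Sum>n\<in>?I - {1}. (1 / real n) powr a) < 1"
    by (auto dest: order_tendstoD(2)[of _ _ _ 1])
  then obtain b where b: "\<And>x. x \<ge> b \<Longrightarrow> (\<Sum>n\<in>?I - {1}. (1 / real n) powr x) < 1"
    by (auto simp: eventually_at_top_linorder)
  have "\<bar>Re s\<bar> \<le> max a b" if "zeta_partial_sum X s = 0" for s
  proof -
    have "\<not> - Re s \<ge> a"
      using zeta_partial_sum_zero_dominated[OF that N] a[of "- Re s"] by auto
    moreover have "(\<Sum>n\<in>?I - {1}. (real n / real 1) powr (- Re s)) = (\<Sum>n\<in>?I - {1}. (1 / real n) powr Re s)"
      by (intro sum.cong refl) (simp add: powr_minus powr_divide field_simps)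
    hence "\<not> Re s \<ge> b"
      using zeta_partial_sum_zero_dominated[OF that, of 1] assms b[of "Re s"] by auto
    ultimately show ?thesis by linarith
  qed
  thus ?thesis by (rule that)
qed

lemma zeta_partial_sum_holomorphic: "zeta_partial_sum X holomorphic_on S"
proof -
  have "(\<lambda>s. of_nat n powr (- s) :: complex) holomorphic_on S" if "1 \<le> n" for n
    using that by (intro holomorphic_intros) auto
  thus ?thesis
    unfolding zeta_partial_sum_def[abs_def] by (intro holomorphic_on_sum) auto
qed

lemma finite_zeta_partial_sum_zeros:
  assumes "1 \<le> X"
  shows "finite (zeta_partial_sum_zeros X T)"
proof (cases "zeta_partial_sum X constant_on UNIV")
  case True
  then obtain c where c: "\<And>s. zeta_partial_sum X s = c"
    by (auto simp: constant_on_def)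
  have "zeta_partial_sum X 0 = of_nat (card {n. 1 \<le> n \<and> real n \<le> X})"
    by (simp add: zeta_partial_sum_def)
  moreover have "{n. 1 \<le> n \<and> real n \<le> X} \<noteq> {}" using assms by (auto intro!: exI[of _ 1])
  ultimately have "c \<noteq> 0" using c[of 0] finite_zeta_index[of X] by (metis card_0_eq of_nat_eq_0_iff)
  thus ?thesis by (simp add: zeta_partial_sum_zeros_def c)
next
  case False
  obtain A where A: "\<And>s. zeta_partial_sum X s = 0 \<Longrightarrow> \<bar>Re s\<bar> \<le> A"
    using zeta_partial_sum_zeros_strip[OF assms] by blast
  let ?K = "cbox (Complex (- A) 0) (Complex A T)"
  have "finite {z \<in> ?K. zeta_partial_sum X z = 0}"
    using False by (intro holomorphic_compact_finite_zeros[of _ UNIV] zeta_partial_sum_holomorphic) auto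
  moreover have "zeta_partial_sum_zeros X T \<subseteq> {z \<in> ?K. zeta_partial_sum X z = 0}"
    using A by (fastforce simp: zeta_partial_sum_zeros_def in_cbox_complex_iff abs_le_iff)
  ultimately show ?thesis by (rule finite_subset[rotated])
qed

end

theory Submission
  imports Defs
begin

text \<open>
  Littlewood's lemma is the argument principle for \<open>(s - a) F'(s) / F(s)\<close> on a rectangle with lower
  left corner \<open>a\<close>, integrated by parts on each edge: it expresses the sum of \<open>\<beta> + U\<close> over the zeros of
  \<open>F\<close> in \<open>[-U, 2] \<times> [0, T]\<close> by \<open>log \<bar>F\<bar>\<close> on the vertical edges and \<open>arg F\<close> on the horizontal ones.

  Let \<open>N = \<lfloor>X\<rfloor>\<close>. On the right edge the first term of \<open>F\<close> dominates, so \<open>log \<bar>F\<bar> = O(1)\<close>. On the left edge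
  the last term does, because \<open>U \<ge> N\<close>, so \<open>log \<bar>F\<bar> = U log N + O(1)\<close>; this edge yields the main term.
  On the bottom edge \<open>F > 0\<close>.

  On the top edge, \<open>arg F\<close> changes by at most \<open>\<pi>\<close> between consecutive zeros of \<open>Re F\<close>, and
  \<open>Re F(\<sigma> + iT) = \<Sum> cos (T log n) exp (- \<sigma> log n)\<close> is a nontrivial real exponential sum with \<open>N\<close>
  terms, so by Rolle's theorem it has fewer than \<open>N\<close> zeros.
\<close>

section \<open>Zeros of exponential sums and the variation of the argument\<close>

lemma card_zeros_le_Suc_card_zeros_deriv:
  fixes f f' :: "real \<Rightarrow> real"
  assumes der: "\<And>x. (f has_real_derivative f' x) (at x)" and fin: "finite {x. f' x = 0}"
  shows "finite {x. f x = 0} \<and> card {x. f x = 0} \<le> Suc (card {x. f' x = 0})"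
proof (rule finite_if_finite_subsets_card_bdd)
  fix Z assume Z: "Z \<subseteq> {x. f x = 0}" "finite Z"
  define succ where "succ x = Min {y \<in> Z. x < y}" for x
  have succ: "succ x \<in> Z" "x < succ x" "\<And>y. y \<in> Z \<Longrightarrow> x < y \<Longrightarrow> succ x \<le> y"
    if x: "x \<in> Z - {Max Z}" for x
  proof -
    have "Max Z \<in> Z" using x Z(2) by (intro Max_in) auto
    then have "Max Z \<in> {y \<in> Z. x < y}" using x Z(2) by (auto simp: order.strict_iff_order)
    then have "succ x \<in> {y \<in> Z. x < y}"
      unfolding succ_def using Z(2) by (intro Min_in) auto
    then show "succ x \<in> Z" "x < succ x" by auto
    show "succ x \<le> y" if "y \<in> Z" "x < y" for y
      using that Z(2) by (auto simp: succ_def)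
  qed
  have "\<exists>z. x < z \<and> z < succ x \<and> f' z = 0" if x: "x \<in> Z - {Max Z}" for x
  proof -
    obtain z where "x < z" "z < succ x" "f (succ x) - f x = (succ x - x) * f' z"
      using MVT2[OF succ(2)[OF x]] der by blast
    moreover have "f x = 0" "f (succ x) = 0" using x succ(1)[OF x] Z(1) by auto
    ultimately show ?thesis using succ(2)[OF x] by auto
  qed
  then obtain \<xi> where \<xi>: "\<And>x. x \<in> Z - {Max Z} \<Longrightarrow> x < \<xi> x \<and> \<xi> x < succ x \<and> f' (\<xi> x) = 0"
    by metis
  have "inj_on \<xi> (Z - {Max Z})"
  proof (rule linorder_inj_onI)
    fix x y assume "x < y" "x \<in> Z - {Max Z}" "y \<in> Z - {Max Z}"
    then show "\<xi> x \<noteq> \<xi> y" using \<xi>[of x] \<xi>[of y] succ(3)[of x y] by auto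
  qed auto
  then have "card (Z - {Max Z}) \<le> card {x. f' x = 0}"
    using \<xi> fin by (intro card_inj_on_le[of \<xi>]) auto
  then show "card Z \<le> Suc (card {x. f' x = 0})"
    using Z(2) card_Diff_singleton_if[of Z "Max Z"] by (auto split: if_splits)
qed

lemma card_zeros_exponential_sum_less:
  fixes l c :: "'a \<Rightarrow> real"
  assumes "finite I" "inj_on l I" "\<exists>i\<in>I. c i \<noteq> 0"
  shows "finite {x. (\<Sum>i\<in>I. c i * exp (l i * x)) = 0} \<and>
    card {x. (\<Sum>i\<in>I. c i * exp (l i * x)) = 0} < card I"
  using assms
proof (induction I arbitrary: l c rule: finite_induct)
  case empty
  then show ?case by simp
next
  case (insert i J)
  show ?case
  proof (cases "\<exists>j\<in>J. c j \<noteq> 0")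
    case False
    then have "c i \<noteq> 0" using insert.prems(2) by auto
    then have "{x. (\<Sum>j\<in>insert i J. c j * exp (l j * x)) = 0} = {}"
      using False insert.hyps by (simp add: sum.neutral)
    then show ?thesis
      using insert.hyps
      by (simp only: finite.emptyI card.empty card_insert_disjoint) simp
  next
    case True
    \<comment> \<open>Dividing by \<open>exp (l i * x)\<close> makes the \<open>i\<close>-th term constant, so differentiation removes it.\<close>
    define f where "f x = c i + (\<Sum>j\<in>J. c j * exp ((l j - l i) * x))" for x
    define f' where "f' x = (\<Sum>j\<in>J. (c j * (l j - l i)) * exp ((l j - l i) * x))" for x
    have "(\<Sum>j\<in>insert i J. c j * exp (l j * x)) = exp (l i * x) * f x" for x
      using insert.hyps
      by (simp add: f_def sum_distrib_left distrib_left exp_diff left_diff_distrib field_simps)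
    then have zeros: "{x. (\<Sum>j\<in>insert i J. c j * exp (l j * x)) = 0} = {x. f x = 0}" by simp
    have "finite {x. f' x = 0} \<and> card {x. f' x = 0} < card J"
      unfolding f'_def using True insert.prems(1) insert.hyps
      by (intro insert.IH) (auto simp: inj_on_def)
    moreover have "(f has_real_derivative f' x) (at x)" for x
      unfolding f_def f'_def by (auto intro!: derivative_eq_intros sum.cong)
    ultimately show ?thesis
      using card_zeros_le_Suc_card_zeros_deriv[of f f'] insert.hyps unfolding zeros by auto
  qed
qed

lemma increment_le_card_cos_zeros:
  fixes \<theta> :: "real \<Rightarrow> real"
  assumes "a \<le> b" "continuous_on {a..b} \<theta>" and fin: "finite {x\<in>{a..b}. cos (\<theta> x) = 0}"
  shows "\<theta> b - \<theta> a \<le> pi * (real (card {x\<in>{a..b}. cos (\<theta> x) = 0}) + 1)"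
proof (rule ccontr)
  let ?Z = "{x\<in>{a..b}. cos (\<theta> x) = 0}"
  assume "\<not> ?thesis"
  then have large: "\<theta> a + pi + real (card ?Z) * pi < \<theta> b" by (simp add: algebra_simps)
  define m where "m = \<lceil>\<theta> a / pi - 1 / 2\<rceil>"
  define v where "v j = real_of_int (m + int j) * pi + pi / 2" for j :: nat
  have "\<theta> a / pi - 1 / 2 \<le> m" "m \<le> \<theta> a / pi - 1 / 2 + 1"
    unfolding m_def by (rule le_of_int_ceiling, rule of_int_ceiling_le_add_one)
  then have m: "\<theta> a \<le> m * pi + pi / 2" "m * pi + pi / 2 \<le> \<theta> a + pi"
    by (simp_all add: field_simps)
  have "\<exists>x. a \<le> x \<and> x \<le> b \<and> \<theta> x = v j" if "j \<le> card ?Z" for j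
  proof (rule IVT')
    have "v j = (m * pi + pi / 2) + real j * pi" by (simp add: v_def algebra_simps)
    moreover have "0 \<le> real j * pi" "real j * pi \<le> real (card ?Z) * pi"
      using that
      by (simp_all only: mult_right_mono mult_nonneg_nonneg of_nat_mono of_nat_0_le_iff pi_ge_zero)
    ultimately show "\<theta> a \<le> v j" "v j \<le> \<theta> b"
      using m large by linarith+
  qed (use assms in auto)
  then obtain x where x: "\<And>j. j \<le> card ?Z \<Longrightarrow> a \<le> x j \<and> x j \<le> b \<and> \<theta> (x j) = v j"
    by metis
  have "inj_on x {..card ?Z}"
  proof (rule inj_onI)
    fix i j assume "i \<in> {..card ?Z}" "j \<in> {..card ?Z}" "x i = x j"
    then have "v i = v j" using x[of i] x[of j] by simp
    then show "i = j" by (simp add: v_def)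
  qed
  moreover have "cos (v j) = 0" for j
    unfolding cos_zero_iff_int2 v_def by blast
  then have "x ` {..card ?Z} \<subseteq> ?Z" using x by auto
  ultimately have "card {..card ?Z} \<le> card ?Z"
    using fin by (rule card_inj_on_le)
  then show False by simp
qed

lemma abs_increment_le_card_cos_zeros:
  fixes \<theta> :: "real \<Rightarrow> real"
  assumes "a \<le> b" "continuous_on {a..b} \<theta>" "finite {x\<in>{a..b}. cos (\<theta> x) = 0}"
  shows "\<bar>\<theta> b - \<theta> a\<bar> \<le> pi * (real (card {x\<in>{a..b}. cos (\<theta> x) = 0}) + 1)"
  using increment_le_card_cos_zeros[OF assms] increment_le_card_cos_zeros[of a b "\<lambda>x. - \<theta> x"] assms
  by (simp add: abs_le_iff continuous_on_minus)

lemma Im_log_exponential_sum_increment_le: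
  fixes l :: "'a \<Rightarrow> real" and c :: "'a \<Rightarrow> complex"
  assumes "finite I" "inj_on l I" and nontrivial: "\<exists>i\<in>I. Re (c i * cis (l i * y)) \<noteq> 0"
    and "a \<le> b" and L: "continuous_on {a..b} L"
      "\<And>x. x \<in> {a..b} \<Longrightarrow> exp (L x) = (\<Sum>i\<in>I. c i * exp (of_real (l i) * Complex x y))"
  shows "\<bar>Im (L b) - Im (L a)\<bar> \<le> pi * card I"
proof -
  let ?Z = "{x. (\<Sum>i\<in>I. Re (c i * cis (l i * y)) * exp (l i * x)) = 0}"
  let ?C = "{x\<in>{a..b}. cos (Im (L x)) = 0}"
  have Z: "finite ?Z" "card ?Z < card I"
    using card_zeros_exponential_sum_less[OF assms(1-3)] by auto
  have "exp (of_real (l i) * Complex x y) = of_real (exp (l i * x)) * cis (l i * y)" for i x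
    by (simp add: exp_eq_polar)
  then have "Re (exp (L x)) = (\<Sum>i\<in>I. Re (c i * cis (l i * y)) * exp (l i * x))"
    if "x \<in> {a..b}" for x
    using L(2)[OF that] by (simp add: algebra_simps)
  then have zeros_subset: "?C \<subseteq> ?Z"
    unfolding Re_exp by force
  have "\<bar>Im (L b) - Im (L a)\<bar> \<le> pi * (real (card ?C) + 1)"
    using \<open>a \<le> b\<close> L(1) finite_subset[OF zeros_subset Z(1)]
    by (intro abs_increment_le_card_cos_zeros continuous_intros)
  also have "\<dots> \<le> pi * card I"
    using card_mono[OF Z(1) zeros_subset] Z(2) by (intro mult_left_mono) auto
  finally show ?thesis .
qed

section \<open>Littlewood's lemma\<close>

lemma has_vector_derivative_continuous_log:
  fixes A g :: "real \<Rightarrow> complex"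
  assumes "t \<in> S" "continuous (at t within S) A" and exp_A: "\<And>u. u \<in> S \<Longrightarrow> exp (A u) = g u"
    and g': "(g has_vector_derivative g') (at t within S)"
  shows "(A has_vector_derivative g' / g t) (at t within S)"
proof -
  have "g t \<noteq> 0" using exp_A[OF \<open>t \<in> S\<close>] exp_not_eq_zero by metis
  obtain d where d: "d > 0" "\<And>u. u \<in> S \<Longrightarrow> dist u t < d \<Longrightarrow> dist (A u) (A t) < pi"
    using assms(2) pi_gt_zero unfolding continuous_within_eps_delta by blast
  have log_near_t: "A t + Ln (g u / g t) = A u" if "u \<in> S" "dist u t < d" for u
  proof -
    have "\<bar>Im (A u - A t)\<bar> < pi"
      using d(2)[OF that] abs_Im_le_cmod[of "A u - A t"] by (simp add: dist_norm)
    moreover have "g u / g t = exp (A u - A t)"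
      using exp_A that \<open>t \<in> S\<close> by (simp add: exp_diff)
    ultimately show ?thesis by (simp add: Ln_exp abs_less_iff)
  qed
  have "((\<lambda>z. A t + Ln (z / g t)) has_field_derivative 1 / g t) (at (g t))"
    using \<open>g t \<noteq> 0\<close> by (auto intro!: derivative_eq_intros)
  then have "((\<lambda>u. A t + Ln (g u / g t)) has_vector_derivative g' / g t) (at t within S)"
    using field_vector_diff_chain_within[OF g' has_field_derivative_at_within]
    by (force simp: o_def)
  then show ?thesis
    by (rule has_vector_derivative_transform_within[OF _ d(1) \<open>t \<in> S\<close>]) (rule log_near_t)
qed

lemma has_contour_integral_log_deriv_linepath_by_parts:
  assumes f: "\<And>z. z \<in> closed_segment a b \<Longrightarrow> f field_differentiable at z"
    and L: "continuous_on (closed_segment a b) L" "\<And>z. z \<in> closed_segment a b \<Longrightarrow> exp (L z) = f z"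
  shows "((\<lambda>s. deriv f s * (s - w) / f s) has_contour_integral
      (b - w) * L b - (a - w) * L a - contour_integral (linepath a b) L) (linepath a b)"
proof -
  let ?\<gamma> = "linepath a b"
  have \<gamma>: "?\<gamma> t \<in> closed_segment a b" if "t \<in> {0..1}" for t
    using that by (rule linepath_in_path)
  have cont: "continuous_on {0..1} (\<lambda>t. L (?\<gamma> t))"
    using \<gamma> by (intro continuous_on_compose2[OF L(1)] continuous_on_linepath) auto
  have L': "((\<lambda>t. L (?\<gamma> t)) has_vector_derivative deriv f (?\<gamma> t) * (b - a) / f (?\<gamma> t))
      (at t within {0..1})" if t: "t \<in> {0..1}" for t
  proof (rule has_vector_derivative_continuous_log[OF t])
    show "continuous (at t within {0..1}) (\<lambda>t. L (?\<gamma> t))"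
      using cont t by (simp add: continuous_on_eq_continuous_within)
    have "(f has_field_derivative deriv f (?\<gamma> t)) (at (?\<gamma> t) within ?\<gamma> ` {0..1})"
      using f[OF \<gamma>[OF t]] by (simp add: field_differentiable_derivI has_field_derivative_at_within)
    from field_vector_diff_chain_within[OF has_vector_derivative_linepath_within this]
    show "((\<lambda>t. f (?\<gamma> t)) has_vector_derivative deriv f (?\<gamma> t) * (b - a)) (at t within {0..1})"
      by (simp add: o_def mult.commute)
  qed (use L(2) \<gamma> in auto)
  have "((\<lambda>t. (?\<gamma> t - w) * L (?\<gamma> t)) has_vector_derivative
      (?\<gamma> t - w) * (deriv f (?\<gamma> t) * (b - a) / f (?\<gamma> t)) + (b - a) * L (?\<gamma> t)) (at t within {0..1})"
    if "t \<in> {0..1}" for t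
    by (intro has_vector_derivative_mult L' that)
       (simp add: has_vector_derivative_diff_const has_vector_derivative_linepath_within)
  then have product: "((\<lambda>t. (?\<gamma> t - w) * (deriv f (?\<gamma> t) * (b - a) / f (?\<gamma> t)) +
      (b - a) * L (?\<gamma> t)) has_integral (?\<gamma> 1 - w) * L (?\<gamma> 1) - (?\<gamma> 0 - w) * L (?\<gamma> 0)) {0..1}"
    by (intro fundamental_theorem_of_calculus) auto
  have log: "((\<lambda>t. (b - a) * L (?\<gamma> t)) has_integral contour_integral ?\<gamma> L) {0..1}"
    using has_contour_integral_integral[OF contour_integrable_continuous_linepath[OF L(1)]]
    by (simp add: has_contour_integral_linepath mult.commute)
  have "((\<lambda>t. (?\<gamma> t - w) * (deriv f (?\<gamma> t) * (b - a) / f (?\<gamma> t))) has_integral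
      (?\<gamma> 1 - w) * L (?\<gamma> 1) - (?\<gamma> 0 - w) * L (?\<gamma> 0) - contour_integral ?\<gamma> L) {0..1}"
    using has_integral_diff[OF product log] by simp
  then show ?thesis
    by (simp add: has_contour_integral_linepath linepath_0' linepath_1' mult_ac)
qed

lemma contour_integral_linepath_same_Im:
  assumes "Im z = c" "Im z' = c" "Re z = a" "Re z' = b" "a < b"
  shows "contour_integral (linepath z z') f = integral {a..b} (\<lambda>x. f (Complex x c))"
proof -
  have "linepath z z' t = linepath (of_real a) (of_real b) t + \<i> * of_real c" for t
    using assms by (simp add: linepath_def complex_eq_iff algebra_simps)
  moreover have "z' - z = of_real b - of_real a"
    using assms by (simp add: complex_eq_iff)
  ultimately have "contour_integral (linepath z z') f =
      contour_integral (linepath (of_real a) (of_real b)) (\<lambda>z. f (z + \<i> * of_real c))"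
    by (simp add: contour_integral_integral)
  also have "\<dots> = integral {a..b} (\<lambda>x. f (Complex x c))"
    using assms by (subst contour_integral_linepath_Reals_eq) (simp_all add: Complex_eq)
  finally show ?thesis .
qed

lemma Im_contour_integral_linepath_same_Im:
  assumes "Im z = c" "Im z' = c" "Re z = a" "Re z' = b" "a < b"
    and f: "continuous_on (closed_segment z z') f"
  shows "Im (contour_integral (linepath z z') f) = integral {a..b} (\<lambda>x. Im (f (Complex x c)))"
proof -
  have "continuous_on {a..b} (\<lambda>x. f (Complex x c))"
    using assms by (intro continuous_on_compose2[OF f] continuous_intros)
      (auto simp: closed_segment_same_Im closed_segment_eq_real_ivl)
  then have "integral {a..b} (Im \<circ> (\<lambda>x. f (Complex x c))) =
      Im (integral {a..b} (\<lambda>x. f (Complex x c)))"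
    by (intro integral_linear integrable_continuous_real bounded_linear_Im)
  then show ?thesis
    using assms by (simp add: contour_integral_linepath_same_Im o_def)
qed

lemma Im_contour_integral_log_linepath_same_Re:
  assumes "Re z = c" "Re z' = c" "Im z = a" "Im z' = b" "a < b"
    and L: "continuous_on (closed_segment z z') L" "\<And>s. s \<in> closed_segment z z' \<Longrightarrow> exp (L s) = f s"
  shows "Im (contour_integral (linepath z z') L) = integral {a..b} (\<lambda>y. ln (norm (f (Complex c y))))"
proof -
  have segment: "Complex c y \<in> closed_segment z z'" if "y \<in> {a..b}" for y
    using that assms(1-5) by (simp add: closed_segment_same_Re closed_segment_eq_real_ivl)
  then have "continuous_on {a..b} (\<lambda>y. L (Complex c y))"
    by (intro continuous_on_compose2[OF L(1)] continuous_intros) auto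
  then have "integral {a..b} (Re \<circ> (\<lambda>y. L (Complex c y))) =
      Re (integral {a..b} (\<lambda>y. L (Complex c y)))"
    by (intro integral_linear integrable_continuous_real bounded_linear_Re)
  moreover have "Re (L (Complex c y)) = ln (norm (f (Complex c y)))" if "y \<in> {a..b}" for y
    by (simp flip: L(2)[OF segment[OF that]])
  then have "integral {a..b} (\<lambda>y. Re (L (Complex c y))) =
      integral {a..b} (\<lambda>y. ln (norm (f (Complex c y))))"
    by (rule integral_cong)
  ultimately show ?thesis
    using assms(1-5) by (simp add: contour_integral_linepath_same_Re o_def)
qed

lemma compact_convex_subset_open_imp_compact_between:
  fixes K S :: "'a::euclidean_space set"
  assumes "compact K" "convex K" "open S" "K \<subseteq> S"
  obtains V C where "open V" "convex V" "compact C" "K \<subseteq> V" "V \<subseteq> C" "C \<subseteq> S"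
proof -
  obtain e where e: "e > 0" "(\<Union>x\<in>K. cball x e) \<subseteq> S"
    using compact_subset_open_imp_cball_epsilon_subset[OF assms(1,3,4)] .
  define nhd where "nhd B = (\<Union>x\<in>K. \<Union>y\<in>B. {x + y})" for B
  show ?thesis
  proof (rule that)
    show "open (nhd (ball 0 e))" unfolding nhd_def by (intro open_sums disjI2 open_ball)
    show "convex (nhd (ball 0 e))" unfolding nhd_def by (intro convex_sums convex_ball assms(2))
    show "compact (nhd (cball 0 e))" unfolding nhd_def by (intro compact_sums' compact_cball assms(1))
    show "K \<subseteq> nhd (ball 0 e)" unfolding nhd_def using e(1) by force
    show "nhd (ball 0 e) \<subseteq> nhd (cball 0 e)" unfolding nhd_def using ball_subset_cball by blast
    have "x + y \<in> cball x e" if "y \<in> cball 0 e" for x y :: 'a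
      using that by (simp add: dist_norm)
    then show "nhd (cball 0 e) \<subseteq> S" unfolding nhd_def using e(2) by blast
  qed
qed

lemma finite_zeros_convex_neighbourhood:
  fixes f :: "complex \<Rightarrow> complex"
  assumes S: "open S" "connected S" and f: "f holomorphic_on S"
    and K: "compact K" "convex K" "K \<subseteq> S" and a: "a \<in> K" "f a \<noteq> 0"
  obtains V where "open V" "convex V" "K \<subseteq> V" "V \<subseteq> S" "finite {z \<in> V. f z = 0}"
proof -
  obtain V C where V: "open V" "convex V" "K \<subseteq> V" "V \<subseteq> C" and C: "compact C" "C \<subseteq> S"
    using compact_convex_subset_open_imp_compact_between[OF K(1,2) S(1) K(3)] by metis
  have "finite {z \<in> C. f z = 0}"
  proof (cases "f constant_on S")
    case True
    then obtain c where c: "\<And>z. z \<in> S \<Longrightarrow> f z = c" by (auto simp: constant_on_def)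
    then have "c \<noteq> 0" using a K(3) by auto
    then have no_zeros: "{z \<in> C. f z = 0} = {}" using c C(2) by auto
    show ?thesis unfolding no_zeros by simp
  next
    case False
    then show ?thesis by (rule holomorphic_compact_finite_zeros[OF f S C])
  qed
  then have "finite {z \<in> V. f z = 0}"
    by (rule finite_subset[rotated]) (use V(4) in auto)
  with V C(2) that show ?thesis by (meson order.trans)
qed

lemma argument_principle_rectpath:
  fixes f h :: "complex \<Rightarrow> complex"
  assumes S: "open S" "connected S" "cbox a b \<subseteq> S"
    and f: "f holomorphic_on S" and h: "h holomorphic_on S"
    and ab: "Re a \<le> Re b" "Im a \<le> Im b"
    and nz: "\<And>z. z \<in> path_image (rectpath a b) \<Longrightarrow> f z \<noteq> 0"
  shows "contour_integral (rectpath a b) (\<lambda>z. deriv f z * h z / f z) =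
    2 * pi * \<i> * (\<Sum>p | p \<in> box a b \<and> f p = 0. h p * zorder f p)"
proof -
  have image: "path_image (rectpath a b) = cbox a b - box a b"
    using ab by (rule path_image_rectpath_cbox_minus_box)
  have "a \<in> path_image (rectpath a b)"
    using pathstart_in_path_image[of "rectpath a b"] by simp
  then have "a \<in> cbox a b" "f a \<noteq> 0" using image nz by auto
  then obtain V where V: "open V" "convex V" "cbox a b \<subseteq> V" "V \<subseteq> S"
    and "finite {z \<in> V. f z = 0}"
    by (rule finite_zeros_convex_neighbourhood[OF S(1,2) f compact_cbox convex_box(1) S(3)])
  then have fin: "finite {z \<in> V. f z = 0 \<or> z \<in> {}}" by simp
  have outside: "winding_number (rectpath a b) z = 0" if "z \<notin> cbox a b" for z
    using ab that by (rule winding_number_rectpath_outside)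
  have "contour_integral (rectpath a b) (\<lambda>z. deriv f z * h z / f z) =
      2 * pi * \<i> * (\<Sum>p | p \<in> V \<and> (f p = 0 \<or> p \<in> {}).
        winding_number (rectpath a b) p * h p * zorder f p)"
  proof (rule argument_principle[OF V(1) convex_connected[OF V(2)]])
    show "f holomorphic_on V - {}" "h holomorphic_on V"
      using f h V(4) by (auto intro: holomorphic_on_subset)
    show "path_image (rectpath a b) \<subseteq> V - {z \<in> V. f z = 0 \<or> z \<in> {}}"
      using nz image V(3) by blast
    show "\<forall>z. z \<notin> V \<longrightarrow> winding_number (rectpath a b) z = 0"
      using outside V(3) by blast
  qed (use fin in auto)
  also have "(\<Sum>p | p \<in> V \<and> (f p = 0 \<or> p \<in> {}).
        winding_number (rectpath a b) p * h p * zorder f p) =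
      (\<Sum>p | p \<in> box a b \<and> f p = 0. h p * zorder f p)"
  proof (rule sum.mono_neutral_cong_right[OF fin])
    show "{p \<in> box a b. f p = 0} \<subseteq> {p \<in> V. f p = 0 \<or> p \<in> {}}"
      using V(3) box_subset_cbox by blast
    have "p \<notin> cbox a b" if "f p = 0" "p \<notin> box a b" for p
      using that nz image by blast
    then show "\<forall>p \<in> {p \<in> V. f p = 0 \<or> p \<in> {}} - {p \<in> box a b. f p = 0}.
        winding_number (rectpath a b) p * h p * zorder f p = 0"
      using outside by auto
  qed (simp add: winding_number_rectpath)
  finally show ?thesis .
qed

lemma contour_integral_log_deriv_rectpath_by_parts:
  fixes a b :: complex
  defines "p \<equiv> Complex (Re b) (Im a)" and "q \<equiv> Complex (Re a) (Im b)"
  assumes f: "\<And>z. z \<in> path_image (rectpath a b) \<Longrightarrow> f field_differentiable at z"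
    and L: "continuous_on (closed_segment a p \<union> closed_segment p b \<union> closed_segment q b) L"
      "\<And>z. z \<in> closed_segment a p \<union> closed_segment p b \<union> closed_segment q b \<Longrightarrow> exp (L z) = f z"
    and M: "continuous_on (closed_segment a q) M" "\<And>z. z \<in> closed_segment a q \<Longrightarrow> exp (M z) = f z"
  shows "contour_integral (rectpath a b) (\<lambda>s. deriv f s * (s - w) / f s) =
    (q - w) * (L q - M q) - (a - w) * (L a - M a) -
    (contour_integral (linepath a p) L + contour_integral (linepath p b) L -
      contour_integral (linepath q b) L - contour_integral (linepath a q) M)"
proof -
  let ?g = "\<lambda>s. deriv f s * (s - w) / f s"
  have rectpath: "rectpath a b = linepath a p +++ linepath p b +++ linepath b q +++ linepath q a"
    by (simp add: rectpath_def Let_def p_def q_def)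
  have image: "path_image (rectpath a b) =
      closed_segment a p \<union> closed_segment p b \<union> closed_segment q b \<union> closed_segment a q"
    unfolding rectpath by (simp add: path_image_join Un_assoc closed_segment_commute)
  have parts: "(?g has_contour_integral
      (v - w) * l v - (u - w) * l u - contour_integral (linepath u v) l) (linepath u v)"
    if "closed_segment u v \<subseteq> path_image (rectpath a b)" "continuous_on (closed_segment u v) l"
      "\<And>z. z \<in> closed_segment u v \<Longrightarrow> exp (l z) = f z" for u v l
    using that f by (intro has_contour_integral_log_deriv_linepath_by_parts) auto
  have "(?g has_contour_integral
      ((p - w) * L p - (a - w) * L a - contour_integral (linepath a p) L) +
      (((b - w) * L b - (p - w) * L p - contour_integral (linepath p b) L) +
      (((q - w) * L q - (b - w) * L b - contour_integral (linepath b q) L) +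
      ((a - w) * M a - (q - w) * M q - contour_integral (linepath q a) M)))) (rectpath a b)"
    unfolding rectpath using L(2) M image
    by (intro has_contour_integral_join parts valid_path_join continuous_on_subset[OF L(1)])
      (auto simp: closed_segment_commute)
  moreover have "contour_integral (linepath b q) L = - contour_integral (linepath q b) L"
    "contour_integral (linepath q a) M = - contour_integral (linepath a q) M"
    using M(1) by (auto intro!: contour_integral_reverse_linepath continuous_on_subset[OF L(1)]
        simp: closed_segment_commute)
  ultimately show ?thesis by (simp add: contour_integral_unique algebra_simps)
qed

lemma continuous_logarithm_on_closed_segment:
  fixes f :: "'a::real_normed_vector \<Rightarrow> complex"
  assumes "continuous_on (closed_segment a b) f" "\<And>z. z \<in> closed_segment a b \<Longrightarrow> f z \<noteq> 0"
  obtains L where "continuous_on (closed_segment a b) L" "\<forall>z\<in>closed_segment a b. exp (L z) = f z"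
  by (metis continuous_logarithm_on_contractible[OF assms(1) _ assms(2)]
      convex_imp_contractible convex_closed_segment)

lemma closed_segment_rectangle_edges:
  fixes a b :: complex
  assumes "Re a \<le> Re b" "Im a \<le> Im b"
  shows "closed_segment a (Complex (Re b) (Im a)) = {z \<in> cbox a b. Im z = Im a}"
    and "closed_segment (Complex (Re b) (Im a)) b = {z \<in> cbox a b. Re z = Re b}"
    and "closed_segment (Complex (Re a) (Im b)) b = {z \<in> cbox a b. Im z = Im b}"
    and "closed_segment a (Complex (Re a) (Im b)) = {z \<in> cbox a b. Re z = Re a}"
  using assms by (auto simp: closed_segment_same_Re closed_segment_same_Im
      closed_segment_eq_real_ivl in_cbox_complex_iff)

definition edges_except_left :: "complex \<Rightarrow> complex \<Rightarrow> complex set" where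
  "edges_except_left a b = {z \<in> cbox a b. Im z = Im a \<or> Re z = Re b \<or> Im z = Im b}"

lemma Im_contour_integral_log_deriv_rectpath:
  fixes a b :: complex
  assumes ab: "Re a < Re b" "Im a < Im b"
    and f: "\<And>z. z \<in> path_image (rectpath a b) \<Longrightarrow> f field_differentiable at z"
    and nz_left: "\<And>z. z \<in> cbox a b \<Longrightarrow> Re z = Re a \<Longrightarrow> f z \<noteq> 0"
    and L: "continuous_on (edges_except_left a b) L"
      "\<And>z. z \<in> edges_except_left a b \<Longrightarrow> exp (L z) = f z"
  shows "Im (contour_integral (rectpath a b) (\<lambda>s. deriv f s * (s - a) / f s)) =
    integral {Im a..Im b} (\<lambda>y. ln (norm (f (Complex (Re a) y)))) -
    integral {Im a..Im b} (\<lambda>y. ln (norm (f (Complex (Re b) y)))) +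
    integral {Re a..Re b} (\<lambda>x. Im (L (Complex x (Im b)))) -
    integral {Re a..Re b} (\<lambda>x. Im (L (Complex x (Im a))))"
proof -
  define p q where "p = Complex (Re b) (Im a)" and "q = Complex (Re a) (Im b)"
  note edges = closed_segment_rectangle_edges[OF ab[THEN less_imp_le], folded p_def q_def]
  have three_edges: "edges_except_left a b =
      closed_segment a p \<union> closed_segment p b \<union> closed_segment q b"
    by (auto simp: edges_except_left_def edges)
  have L_edges: "continuous_on (closed_segment a p) L" "continuous_on (closed_segment p b) L"
    "continuous_on (closed_segment q b) L"
    using continuous_on_subset[OF L(1)] by (auto simp: three_edges)
  have "closed_segment a q \<subseteq> path_image (rectpath a b)"
    using ab by (auto simp: edges path_image_rectpath in_cbox_complex_iff)
  then have "continuous_on (closed_segment a q) f"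
    using f
    by (intro continuous_at_imp_continuous_on ballI field_differentiable_imp_continuous_at) auto
  \<comment> \<open>As \<open>s - a\<close> is imaginary on the left edge, only \<open>Re M = log \<bar>f\<bar>\<close> enters there, and \<open>M\<close> need not
    agree with \<open>L\<close> at the corners.\<close>
  then obtain M where M: "continuous_on (closed_segment a q) M"
      "\<forall>z\<in>closed_segment a q. exp (M z) = f z"
    by (rule continuous_logarithm_on_closed_segment) (use nz_left edges(4) in auto)
  have "contour_integral (rectpath a b) (\<lambda>s. deriv f s * (s - a) / f s) =
    (q - a) * (L q - M q) - (a - a) * (L a - M a) -
    (contour_integral (linepath a p) L + contour_integral (linepath p b) L -
      contour_integral (linepath q b) L - contour_integral (linepath a q) M)"
    unfolding p_def q_def using f L M
    by (intro contour_integral_log_deriv_rectpath_by_parts) (auto simp: three_edges p_def q_def)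
  moreover have
    "Im (contour_integral (linepath a p) L) = integral {Re a..Re b} (\<lambda>x. Im (L (Complex x (Im a))))"
    "Im (contour_integral (linepath q b) L) = integral {Re a..Re b} (\<lambda>x. Im (L (Complex x (Im b))))"
    using ab L_edges by (simp_all add: Im_contour_integral_linepath_same_Im p_def q_def)
  moreover have "Im (contour_integral (linepath p b) L) =
      integral {Im a..Im b} (\<lambda>y. ln (norm (f (Complex (Re b) y))))"
    using ab L_edges L(2)
    by (intro Im_contour_integral_log_linepath_same_Re) (auto simp: three_edges p_def)
  moreover have "Im (contour_integral (linepath a q) M) =
      integral {Im a..Im b} (\<lambda>y. ln (norm (f (Complex (Re a) y))))"
    using ab M by (intro Im_contour_integral_log_linepath_same_Re) (auto simp: q_def)
  moreover have "norm (exp (L q)) = norm (exp (M q))"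
    using L(2) M(2) by (simp add: three_edges)
  then have "Re (L q) = Re (M q)" by simp
  ultimately show ?thesis by (simp add: q_def)
qed

theorem Littlewood_lemma:
  fixes f L :: "complex \<Rightarrow> complex"
  assumes S: "open S" "connected S" "cbox a b \<subseteq> S" and f: "f holomorphic_on S"
    and ab: "Re a < Re b" "Im a < Im b"
    and nz_left: "\<And>z. z \<in> cbox a b \<Longrightarrow> Re z = Re a \<Longrightarrow> f z \<noteq> 0"
    and L: "continuous_on (edges_except_left a b) L"
      "\<And>z. z \<in> edges_except_left a b \<Longrightarrow> exp (L z) = f z"
  shows "2 * pi * (\<Sum>\<rho> | \<rho> \<in> box a b \<and> f \<rho> = 0. zorder f \<rho> * (Re \<rho> - Re a)) =
    integral {Im a..Im b} (\<lambda>y. ln (norm (f (Complex (Re a) y)))) -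
    integral {Im a..Im b} (\<lambda>y. ln (norm (f (Complex (Re b) y)))) +
    integral {Re a..Re b} (\<lambda>x. Im (L (Complex x (Im b)))) -
    integral {Re a..Re b} (\<lambda>x. Im (L (Complex x (Im a))))"
proof -
  have image: "path_image (rectpath a b) = edges_except_left a b \<union> {z \<in> cbox a b. Re z = Re a}"
    using ab by (auto simp: path_image_rectpath in_cbox_complex_iff edges_except_left_def)
  have nz: "f z \<noteq> 0" if "z \<in> path_image (rectpath a b)" for z
    using that nz_left L(2)[of z] exp_not_eq_zero[of "L z"] by (auto simp: image)
  have diff: "f field_differentiable at z" if "z \<in> path_image (rectpath a b)" for z
    using that S f holomorphic_on_imp_differentiable_at[of f S z]
    by (auto simp: image edges_except_left_def)
  have "2 * pi * (\<Sum>\<rho> | \<rho> \<in> box a b \<and> f \<rho> = 0. zorder f \<rho> * (Re \<rho> - Re a)) =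
      Im (2 * pi * \<i> * (\<Sum>\<rho> | \<rho> \<in> box a b \<and> f \<rho> = 0. (\<rho> - a) * zorder f \<rho>))"
    by (simp add: mult.commute)
  also have "\<dots> = Im (contour_integral (rectpath a b) (\<lambda>s. deriv f s * (s - a) / f s))"
    using ab
    by (subst argument_principle_rectpath[OF S f _ _ _ nz]) (auto intro: holomorphic_intros)
  also note Im_contour_integral_log_deriv_rectpath[OF ab diff nz_left L]
  finally show ?thesis .
qed

lemma continuous_log_extend:
  fixes f :: "'a::real_normed_vector \<Rightarrow> complex"
  assumes A: "closed A" "continuous_on A L" "\<And>z. z \<in> A \<Longrightarrow> exp (L z) = f z"
    and B: "closed B" "contractible B" "continuous_on B f" "\<And>z. z \<in> B \<Longrightarrow> f z \<noteq> 0"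
    and p: "A \<inter> B = {p}"
  obtains L' where "continuous_on (A \<union> B) L'" "\<And>z. z \<in> A \<union> B \<Longrightarrow> exp (L' z) = f z"
    "\<And>z. z \<in> A \<Longrightarrow> L' z = L z"
proof -
  obtain M where M: "continuous_on B M" "\<forall>z\<in>B. f z = exp (M z)"
    by (metis continuous_logarithm_on_contractible[OF B(3,2,4)])
  have "p \<in> A" "p \<in> B" using p by auto
  define L' where "L' z = (if z \<in> A then L z else M z - M p + L p)" for z
  show ?thesis
  proof
    show "continuous_on (A \<union> B) L'"
      unfolding L'_def
    proof (rule continuous_on_cases[OF A(1) B(1) A(2)])
      show "continuous_on B (\<lambda>z. M z - M p + L p)"
        using M(1) by (intro continuous_intros)
      have "L z = M z - M p + L p" if "z \<in> A" "z \<in> B" for z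
      proof -
        have "z = p" using that p by blast
        then show ?thesis by simp
      qed
      then show "\<forall>z. z \<in> A \<and> z \<notin> A \<or> z \<in> B \<and> z \<in> A \<longrightarrow> L z = M z - M p + L p"
        by blast
    qed
    have "exp (L p) = exp (M p)" using A(3)[OF \<open>p \<in> A\<close>] M(2) \<open>p \<in> B\<close> by simp
    then have "exp (M z - M p + L p) = f z" if "z \<in> B" for z
      using M(2) that by (simp add: exp_add exp_diff field_simps)
    then show "exp (L' z) = f z" if "z \<in> A \<union> B" for z
      using A(3) that by (auto simp: L'_def)
  qed (simp add: L'_def)
qed

section \<open>Partial sums of the zeta function\<close>

lemma abs_integral_diff_const_le:
  fixes f :: "real \<Rightarrow> real"
  assumes "a \<le> b" "continuous_on {a..b} f" "\<And>x. x \<in> {a..b} \<Longrightarrow> \<bar>f x - c\<bar> \<le> B"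
  shows "\<bar>integral {a..b} f - c * (b - a)\<bar> \<le> B * (b - a)"
proof -
  have "integral {a..b} (\<lambda>x. f x - c) = integral {a..b} f - c * (b - a)"
    using assms
    by (subst Henstock_Kurzweil_Integration.integral_diff) (auto intro!: integrable_continuous_real)
  moreover have "continuous_on {a..b} (\<lambda>x. f x - c)"
    using assms(2) by (intro continuous_intros)
  ultimately show ?thesis
    using integral_bound[OF assms(1), of "\<lambda>x. f x - c" B] assms(3) by simp
qed

lemma abs_ln_norm_le_near_1:
  fixes z :: "'a::real_normed_algebra_1"
  assumes "norm (z - 1) \<le> r" "r < 1"
  shows "\<bar>ln (norm z)\<bar> \<le> r / (1 - r)"
proof -
  have z: "1 - r \<le> norm z" "norm z \<le> 1 + r"
    using assms(1) norm_triangle_ineq3[of z 1] by auto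
  have "z \<noteq> 0" using z(1) assms(2) by auto
  have "0 \<le> r" using norm_ge_zero assms(1) by (rule order.trans)
  have "ln (norm z) \<le> r" using z assms(2) ln_le_minus_one[of "norm z"] by linarith
  also have "r * (1 - r) \<le> r" using \<open>0 \<le> r\<close> by (simp add: mult_left_le)
  then have "r \<le> r / (1 - r)" using assms(2) by (simp add: pos_le_divide_eq)
  finally have "ln (norm z) \<le> r / (1 - r)" .
  moreover have "- ln (norm z) \<le> inverse (1 - r) - 1"
  proof -
    have "- ln (norm z) \<le> inverse (norm z) - 1"
      using \<open>z \<noteq> 0\<close> ln_le_minus_one[of "inverse (norm z)"] by (simp add: ln_inverse)
    also have "inverse (norm z) \<le> inverse (1 - r)"
      using z(1) assms(2) by (intro le_imp_inverse_le) auto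
    finally show ?thesis by simp
  qed
  moreover have "inverse (1 - r) - 1 = r / (1 - r)" using assms(2) by (simp add: field_simps)
  ultimately show ?thesis by linarith
qed

lemma sum_inverse_squares_le: "(\<Sum>n=2..N. 1 / (real n)\<^sup>2) \<le> 2 / 3"
proof -
  have "(\<Sum>n=2..N. 1 / (real n)\<^sup>2) = (\<Sum>n=1..<N. 1 / (real n + 1)\<^sup>2)"
    by (rule sum.reindex_bij_witness[of _ "\<lambda>n. n + 1" "\<lambda>n. n - 1"]) auto
  also have "\<dots> = (\<Sum>n\<in>insert 0 {1..<N}. 1 / (real n + 1)\<^sup>2) - 1"
    by simp
  also have "\<dots> \<le> pi\<^sup>2 / 6 - 1"
  proof -
    have sums: "(\<lambda>n. 1 / (real n + 1)\<^sup>2) sums (pi\<^sup>2 / 6)"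
      using inverse_squares_sums by (simp add: add.commute)
    show ?thesis
      unfolding sums_unique[OF sums]
      by (intro diff_right_mono sum_le_suminf sums_summable[OF sums]) auto
  qed
  also have "\<dots> \<le> 2 / 3"
  proof -
    have "pi \<le> 3.15" using pi_approx(2) by simp
    then have "pi\<^sup>2 \<le> 3.15\<^sup>2" by (rule power_mono) simp
    then show ?thesis by (simp add: power2_eq_square)
  qed
  finally show ?thesis .
qed

lemma sum_geometric_rev_le:
  fixes x :: real
  assumes "0 \<le> x" "x < 1"
  shows "(\<Sum>n<N. x ^ (N - n)) \<le> x / (1 - x)"
proof -
  have "(\<Sum>n<N. x ^ (N - n)) = (\<Sum>n<N. x * x ^ (N - Suc n))"
    by (intro sum.cong) (auto simp flip: power_Suc simp: Suc_diff_Suc)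
  also have "\<dots> = x * (\<Sum>n<N. x ^ n)"
    by (simp add: sum.nat_diff_reindex flip: sum_distrib_left)
  also have "\<dots> \<le> x * (1 / (1 - x))"
    using assms suminf_geometric[of x]
    by (intro mult_left_mono sum_le_suminf[THEN order.trans]) auto
  finally show ?thesis by simp
qed

lemma norm_of_nat_powr: "norm (of_nat n powr s :: complex) = real n powr Re s"
  by (simp add: norm_powr_real_powr)

lemma zeta_partial_sum_of_nat: "zeta_partial_sum (real N) s = (\<Sum>n=1..N. of_nat n powr (- s))"
  unfolding zeta_partial_sum_def by (intro sum.cong) auto

lemma zeta_partial_sum_floor: "zeta_partial_sum X = zeta_partial_sum (real (nat \<lfloor>X\<rfloor>))"
proof -
  have "{n. 1 \<le> n \<and> real n \<le> X} = {n. 1 \<le> n \<and> real n \<le> real (nat \<lfloor>X\<rfloor>)}"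
    by (auto simp: le_nat_floor) linarith
  then show ?thesis by (simp add: zeta_partial_sum_def[abs_def])
qed

lemma zeta_partial_sum_eq_exponential_sum:
  "zeta_partial_sum (real N) s = (\<Sum>n=1..N. exp (of_real (- ln (real n)) * s))"
  unfolding zeta_partial_sum_of_nat by (intro sum.cong) (auto simp: powr_def Ln_of_nat mult.commute)

lemma continuous_on_zeta_partial_sum: "continuous_on A (zeta_partial_sum X)"
  by (intro holomorphic_on_imp_continuous_on zeta_partial_sum_holomorphic)

lemma zeta_partial_sum_real_axis:
  assumes "N \<ge> 1" "Im s = 0"
  shows "Im (zeta_partial_sum (real N) s) = 0" "Re (zeta_partial_sum (real N) s) > 0"
proof -
  have "s = of_real (Re s)" using assms(2) by (simp add: complex_eq_iff)
  then have "of_nat n powr (- s) = complex_of_real (real n powr (- Re s))" for n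
    using powr_of_real[of "real n" "- Re s"] by simp
  then have "zeta_partial_sum (real N) s = of_real (\<Sum>n=1..N. real n powr (- Re s))"
    by (simp add: zeta_partial_sum_of_nat)
  moreover have "(\<Sum>n=1..N. real n powr (- Re s)) > 0"
    using assms(1) by (intro sum_pos) auto
  ultimately show "Im (zeta_partial_sum (real N) s) = 0" "Re (zeta_partial_sum (real N) s) > 0"
    by simp_all
qed

lemma norm_zeta_partial_sum_minus_1_le:
  assumes "N \<ge> 1" "Re s \<ge> 2"
  shows "norm (zeta_partial_sum (real N) s - 1) \<le> 2 / 3"
proof -
  have "zeta_partial_sum (real N) s - 1 = (\<Sum>n=2..N. of_nat n powr (- s))"
    using assms(1) by (simp add: zeta_partial_sum_of_nat sum.atLeast_Suc_atMost numeral_2_eq_2)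
  also have "norm \<dots> \<le> (\<Sum>n=2..N. 1 / (real n)\<^sup>2)"
  proof (rule sum_norm_le)
    fix n assume n: "n \<in> {2..N}"
    have "norm (of_nat n powr (- s) :: complex) = real n powr (- Re s)"
      by (simp add: norm_of_nat_powr)
    also have "\<dots> \<le> real n powr (- 2)"
      using n assms(2) by (intro powr_mono) auto
    also have "\<dots> = 1 / (real n)\<^sup>2"
      using n by (simp add: powr_minus_divide)
    finally show "norm (of_nat n powr (- s) :: complex) \<le> 1 / (real n)\<^sup>2" .
  qed
  also have "\<dots> \<le> 2 / 3" by (rule sum_inverse_squares_le)
  finally show ?thesis .
qed

lemma ratio_powr_le_exp:
  fixes x y :: real
  assumes "0 < x" "x \<le> y" "y \<le> u"
  shows "(x / y) powr u \<le> exp (x - y)"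
proof -
  have "u * ln (x / y) \<le> y * ln (x / y)"
    using assms by (intro mult_right_mono_neg) auto
  also have "\<dots> \<le> y * (x / y - 1)"
    using assms by (intro mult_left_mono ln_le_minus_one) auto
  also have "\<dots> = x - y" using assms by (simp add: field_simps)
  finally show ?thesis using assms by (simp add: powr_def)
qed

lemma norm_scaled_zeta_partial_sum_minus_1_le:
  assumes "N \<ge> 1" "Re s \<le> - real N"
  shows "norm (of_nat N powr s * zeta_partial_sum (real N) s - 1) \<le> 2 / 3"
proof -
  have "{1..N} = insert N {1..<N}" using assms(1) by auto
  then have "of_nat N powr s * zeta_partial_sum (real N) s - 1 =
      (\<Sum>n=1..<N. of_nat N powr s * of_nat n powr (- s))"
    using assms(1)
    by (simp add: zeta_partial_sum_of_nat distrib_left sum_distrib_left flip: powr_add)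
  also have "norm \<dots> \<le> (\<Sum>n=1..<N. (2 / 5) ^ (N - n))"
  proof (rule sum_norm_le)
    fix n assume n: "n \<in> {1..<N}"
    have "norm (of_nat N powr s * of_nat n powr (- s) :: complex) = (real n / real N) powr (- Re s)"
      using n unfolding norm_mult norm_of_nat_powr by (simp add: powr_divide powr_minus field_simps)
    also have "\<dots> \<le> exp (real n - real N)"
      using n assms(2) by (intro ratio_powr_le_exp) auto
    also have "\<dots> = exp (- 1) ^ (N - n)"
      using n by (simp add: of_nat_diff flip: exp_of_nat_mult)
    also have "\<dots> \<le> (2 / 5) ^ (N - n)"
    proof (rule power_mono)
      have "5 / 2 \<le> exp (1 :: real)" using exp_lower_Taylor_quadratic[of 1] by simp
      then show "exp (- 1) \<le> (2 / 5 :: real)"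
        using le_imp_inverse_le[of "5 / 2" "exp 1 :: real"] by (simp add: exp_minus)
    qed simp
    finally show "norm (of_nat N powr s * of_nat n powr (- s) :: complex) \<le> (2 / 5) ^ (N - n)" .
  qed
  also have "\<dots> \<le> (\<Sum>n<N. (2 / 5) ^ (N - n))"
    by (intro sum_mono2) auto
  also have "\<dots> \<le> 2 / 3" using sum_geometric_rev_le[of "2 / 5" N] by simp
  finally show ?thesis .
qed

lemma zeta_partial_sum_nonzero_right: "N \<ge> 1 \<Longrightarrow> Re s \<ge> 2 \<Longrightarrow> zeta_partial_sum (real N) s \<noteq> 0"
  using norm_zeta_partial_sum_minus_1_le[of N s] by auto

lemma zeta_partial_sum_nonzero_left: "N \<ge> 1 \<Longrightarrow> Re s \<le> - real N \<Longrightarrow> zeta_partial_sum (real N) s \<noteq> 0"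
  using norm_scaled_zeta_partial_sum_minus_1_le[of N s] by auto

lemma abs_ln_norm_zeta_partial_sum_right_le:
  assumes "N \<ge> 1" "Re s \<ge> 2"
  shows "\<bar>ln (norm (zeta_partial_sum (real N) s))\<bar> \<le> 2"
  using abs_ln_norm_le_near_1[OF norm_zeta_partial_sum_minus_1_le[OF assms]] by simp

lemma abs_ln_norm_zeta_partial_sum_left_le:
  assumes "N \<ge> 1" "Re s \<le> - real N"
  shows "\<bar>ln (norm (zeta_partial_sum (real N) s)) + Re s * ln (real N)\<bar> \<le> 2"
proof -
  have "ln (norm (of_nat N powr s * zeta_partial_sum (real N) s)) =
      ln (norm (zeta_partial_sum (real N) s)) + Re s * ln (real N)"
    using assms(1) zeta_partial_sum_nonzero_left[OF assms]
    by (simp add: norm_mult norm_of_nat_powr ln_mult ln_powr)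
  then show ?thesis
    using abs_ln_norm_le_near_1[OF norm_scaled_zeta_partial_sum_minus_1_le[OF assms]] by simp
qed

lemma zeta_partial_sum_not_nonpos_Reals:
  assumes "N \<ge> 1" "Im s = 0 \<or> Re s \<ge> 2"
  shows "zeta_partial_sum (real N) s \<notin> \<real>\<^sub>\<le>\<^sub>0"
proof (cases "Im s = 0")
  case True
  then show ?thesis
    using zeta_partial_sum_real_axis[OF assms(1) True] by (auto simp: complex_nonpos_Reals_iff)
next
  case False
  then have "norm (zeta_partial_sum (real N) s - 1) \<le> 2 / 3"
    using assms by (intro norm_zeta_partial_sum_minus_1_le) auto
  then show ?thesis
    using abs_Re_le_cmod[of "zeta_partial_sum (real N) s - 1"]
    by (auto simp: complex_nonpos_Reals_iff)
qed

lemma integral_ln_norm_zeta_partial_sum_right: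
  assumes "N \<ge> 1" "x \<ge> 2" "c \<le> d"
  shows "\<bar>integral {c..d} (\<lambda>y. ln (norm (zeta_partial_sum (real N) (Complex x y))))\<bar> \<le> 2 * (d - c)"
proof -
  have "\<bar>integral {c..d} (\<lambda>y. ln (norm (zeta_partial_sum (real N) (Complex x y)))) - 0 * (d - c)\<bar>
      \<le> 2 * (d - c)"
    using assms abs_ln_norm_zeta_partial_sum_right_le[of N]
    by (intro abs_integral_diff_const_le continuous_intros
        continuous_on_compose2[OF continuous_on_zeta_partial_sum[of UNIV]])
      (auto simp: zeta_partial_sum_nonzero_right)
  then show ?thesis by simp
qed

lemma integral_ln_norm_zeta_partial_sum_left:
  assumes "N \<ge> 1" "x \<le> - real N" "c \<le> d"
  shows "\<bar>integral {c..d} (\<lambda>y. ln (norm (zeta_partial_sum (real N) (Complex x y)))) +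
      x * ln (real N) * (d - c)\<bar> \<le> 2 * (d - c)"
proof -
  have "\<bar>integral {c..d} (\<lambda>y. ln (norm (zeta_partial_sum (real N) (Complex x y)))) -
      (- x * ln (real N)) * (d - c)\<bar> \<le> 2 * (d - c)"
    using assms abs_ln_norm_zeta_partial_sum_left_le[of N "Complex x _"]
    by (intro abs_integral_diff_const_le continuous_intros
        continuous_on_compose2[OF continuous_on_zeta_partial_sum[of UNIV]])
      (auto simp: zeta_partial_sum_nonzero_left)
  then show ?thesis by simp
qed

lemma Im_log_zeta_partial_sum_increment_le:
  assumes "N \<ge> 1" "a \<le> b" "continuous_on {a..b} (\<lambda>x. L (Complex x y))"
    and "\<And>x. x \<in> {a..b} \<Longrightarrow> exp (L (Complex x y)) = zeta_partial_sum (real N) (Complex x y)"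
  shows "\<bar>Im (L (Complex b y)) - Im (L (Complex a y))\<bar> \<le> pi * real N"
proof -
  have "\<exists>n\<in>{1..N}. Re (1 * cis (- ln (real n) * y)) \<noteq> 0"
    using assms(1) by (intro bexI[of _ 1]) auto
  moreover have "inj_on (\<lambda>n. - ln (real n)) {1..N}"
    by (auto simp: inj_on_def)
  moreover have
    "exp (L (Complex x y)) = (\<Sum>n=1..N. 1 * exp (of_real (- ln (real n)) * Complex x y))"
    if "x \<in> {a..b}" for x
    using assms(4)[OF that] unfolding zeta_partial_sum_eq_exponential_sum by simp
  ultimately show ?thesis
    using Im_log_exponential_sum_increment_le[of "{1..N}" "\<lambda>n. - ln (real n)" "\<lambda>_. 1" y a b
        "\<lambda>x. L (Complex x y)"] assms(2,3) by simp
qed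

lemma log_zeta_partial_sum_edges_except_left:
  fixes \<sigma> T :: real
  assumes "N \<ge> 1" "\<sigma> \<le> 2" "T > 0"
    and nz: "\<And>s. Im s = T \<Longrightarrow> zeta_partial_sum (real N) s \<noteq> 0"
  defines "E \<equiv> edges_except_left (Complex \<sigma> 0) (Complex 2 T)"
  obtains L where "continuous_on E L" "\<forall>s\<in>E. exp (L s) = zeta_partial_sum (real N) s"
    "\<forall>s\<in>E. Im s = 0 \<or> Re s = 2 \<longrightarrow> L s = Ln (zeta_partial_sum (real N) s)"
proof -
  let ?F = "zeta_partial_sum (real N)" and ?R = "cbox (Complex \<sigma> 0) (Complex 2 T)"
  let ?A = "{s \<in> ?R. Im s = 0 \<or> Re s = 2}" and ?B = "closed_segment (Complex \<sigma> T) (Complex 2 T)"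
  have B: "?B = {s \<in> ?R. Im s = T}"
    using assms(2,3)
    by (auto simp: closed_segment_same_Im closed_segment_eq_real_ivl in_cbox_complex_iff)
  have corner: "?A \<inter> ?B = {Complex 2 T}"
    using assms(2,3) unfolding B by (auto simp: in_cbox_complex_iff complex_eq_iff)
  have E: "E = ?A \<union> ?B"
    unfolding B by (auto simp: E_def edges_except_left_def)
  have Ln_A: "?F s \<notin> \<real>\<^sub>\<le>\<^sub>0" "?F s \<noteq> 0" if "s \<in> ?A" for s
    using zeta_partial_sum_not_nonpos_Reals[OF \<open>N \<ge> 1\<close>, of s] that by auto
  obtain L where L: "continuous_on (?A \<union> ?B) L" "\<And>s. s \<in> ?A \<union> ?B \<Longrightarrow> exp (L s) = ?F s"
    "\<And>s. s \<in> ?A \<Longrightarrow> L s = Ln (?F s)"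
  proof (rule continuous_log_extend[where f = ?F and A = ?A and B = ?B and L = "\<lambda>s. Ln (?F s)"])
    have "?A = ?R \<inter> ({s. Im s = 0} \<union> {s. Re s = 2})" by auto
    then show "closed ?A"
      by (auto intro!: closed_Int closed_Un closed_Collect_eq continuous_intros)
    show "continuous_on ?A (\<lambda>s. Ln (?F s))"
      using Ln_A(1) by (intro continuous_intros continuous_on_zeta_partial_sum) auto
    show "contractible ?B" by (intro convex_imp_contractible convex_closed_segment)
    show "?F s \<noteq> 0" if "s \<in> ?B" for s using that nz by (auto simp: B)
  qed (use corner Ln_A(2) in \<open>auto intro: continuous_on_zeta_partial_sum\<close>)
  show ?thesis
    by (rule that[of L]) (use L E in \<open>auto simp: E_def edges_except_left_def\<close>)
qed

lemma zeta_partial_sum_zeros_eq_box: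
  assumes "N \<ge> 1" "U \<ge> real N" and nz: "\<And>s. Im s = T \<Longrightarrow> zeta_partial_sum (real N) s \<noteq> 0"
  shows "zeta_partial_sum_zeros (real N) T =
    {s \<in> box (Complex (- U) 0) (Complex 2 T). zeta_partial_sum (real N) s = 0}"
proof -
  have "- U < Re s \<and> Re s < 2 \<and> Im s \<noteq> T" if "zeta_partial_sum (real N) s = 0" for s
    using zeta_partial_sum_nonzero_left[of N s] zeta_partial_sum_nonzero_right[of N s] nz[of s] assms that
    by force
  then show ?thesis by (fastforce simp: zeta_partial_sum_zeros_def in_box_complex_iff)
qed

definition weighted_zero_sum :: "real \<Rightarrow> real \<Rightarrow> real \<Rightarrow> real" where
  "weighted_zero_sum X T U =
    (\<Sum>\<rho>\<in>zeta_partial_sum_zeros X T. real_of_int (zorder (zeta_partial_sum X) \<rho>) * (Re \<rho> + U))"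

lemma weighted_zero_sum_eq_integrals:
  assumes "N \<ge> 1" "U \<ge> real N" "T > 0"
    and nz: "\<And>s. Im s = T \<Longrightarrow> zeta_partial_sum (real N) s \<noteq> 0"
  obtains \<theta> where "continuous_on {- U..2} \<theta>" "\<forall>x\<in>{- U..2}. \<bar>\<theta> x\<bar> \<le> pi * (real N + 1)"
    "2 * pi * weighted_zero_sum (real N) T U =
      integral {0..T} (\<lambda>y. ln (norm (zeta_partial_sum (real N) (Complex (- U) y)))) -
      integral {0..T} (\<lambda>y. ln (norm (zeta_partial_sum (real N) (Complex 2 y)))) +
      integral {- U..2} \<theta>"
proof -
  let ?F = "zeta_partial_sum (real N)" and ?E = "edges_except_left (Complex (- U) 0) (Complex 2 T)"
  have U: "- U \<le> 2" using assms(2) by linarith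
  obtain L where L: "continuous_on ?E L" "\<forall>s\<in>?E. exp (L s) = ?F s"
      "\<forall>s\<in>?E. Im s = 0 \<or> Re s = 2 \<longrightarrow> L s = Ln (?F s)"
    using log_zeta_partial_sum_edges_except_left[OF assms(1) U assms(3) nz] .
  have edges: "Complex x 0 \<in> ?E" "Complex x T \<in> ?E" if "x \<in> {- U..2}" for x
    using that assms(3) by (auto simp: edges_except_left_def in_cbox_complex_iff)
  define \<theta> where "\<theta> x = Im (L (Complex x T))" for x
  have cont: "continuous_on {x..2} (\<lambda>x. L (Complex x T))" if "x \<in> {- U..2}" for x
    using edges that by (intro continuous_on_compose2[OF L(1)] continuous_intros) auto
  have bound: "\<bar>\<theta> x\<bar> \<le> pi * (real N + 1)" if "x \<in> {- U..2}" for x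
  proof -
    have "\<bar>\<theta> 2 - \<theta> x\<bar> \<le> pi * real N"
      unfolding \<theta>_def using assms(1) cont edges that L(2)
      by (intro Im_log_zeta_partial_sum_increment_le) auto
    moreover have "\<bar>\<theta> 2\<bar> \<le> pi"
      using Im_Ln_le_pi mpi_less_Im_Ln[of "?F (Complex 2 T)"] nz[of "Complex 2 T"] L(3) edges(2)[of 2] U
      by (force simp: \<theta>_def abs_le_iff)
    ultimately show ?thesis by (simp add: algebra_simps)
  qed
  have "Im (L (Complex x 0)) = 0" if "x \<in> {- U..2}" for x
    using L(3) edges(1)[OF that] zeta_partial_sum_real_axis[OF assms(1), of "Complex x 0"]
    by (cases "?F (Complex x 0) = 0") (auto simp: Im_Ln_eq_0)
  then have bottom: "integral {- U..2} (\<lambda>x. Im (L (Complex x 0))) = 0"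
    by (subst integral_cong[where g = "\<lambda>_. 0"]) auto
  have zeros: "zeta_partial_sum_zeros (real N) T =
      {s \<in> box (Complex (- U) 0) (Complex 2 T). ?F s = 0}"
    using assms(1,2) nz by (rule zeta_partial_sum_zeros_eq_box)
  show ?thesis
  proof (rule that[of \<theta>])
    show "continuous_on {- U..2} \<theta>"
      unfolding \<theta>_def using cont[of "- U"] U by (intro continuous_intros) auto
    show "2 * pi * weighted_zero_sum (real N) T U =
        integral {0..T} (\<lambda>y. ln (norm (?F (Complex (- U) y)))) -
        integral {0..T} (\<lambda>y. ln (norm (?F (Complex 2 y)))) + integral {- U..2} \<theta>"
      using Littlewood_lemma[of UNIV "Complex (- U) 0" "Complex 2 T" ?F L] L(1,2) bottom assms(1-3)
      by (simp add: weighted_zero_sum_def zeros \<theta>_def[abs_def] zeta_partial_sum_holomorphic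
          zeta_partial_sum_nonzero_left connected_UNIV)
  qed (use bound in blast)
qed

lemma weighted_zero_sum_estimate_zero_free_top:
  assumes "N \<ge> 1" "U \<ge> real N" "T > 0"
    and nz: "\<And>s. Im s = T \<Longrightarrow> zeta_partial_sum (real N) s \<noteq> 0"
  shows "\<bar>2 * pi * weighted_zero_sum (real N) T U - U * ln (real N) * T\<bar>
      \<le> 4 * T + pi * (real N + 1) * (U + 2)"
proof -
  obtain \<theta> where \<theta>: "continuous_on {- U..2} \<theta>" "\<forall>x\<in>{- U..2}. \<bar>\<theta> x\<bar> \<le> pi * (real N + 1)"
    and Littlewood: "2 * pi * weighted_zero_sum (real N) T U =
      integral {0..T} (\<lambda>y. ln (norm (zeta_partial_sum (real N) (Complex (- U) y)))) -
      integral {0..T} (\<lambda>y. ln (norm (zeta_partial_sum (real N) (Complex 2 y)))) +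
      integral {- U..2} \<theta>"
    using weighted_zero_sum_eq_integrals[OF assms] .
  have "\<bar>integral {- U..2} \<theta> - 0 * (2 - - U)\<bar> \<le> pi * (real N + 1) * (2 - - U)"
    using \<theta> assms(2) by (intro abs_integral_diff_const_le) auto
  then show ?thesis
    unfolding Littlewood
    using integral_ln_norm_zeta_partial_sum_left[of N "- U" 0 T]
      integral_ln_norm_zeta_partial_sum_right[of N 2 0 T] assms(1-3)
    by (simp add: algebra_simps)
qed

lemma eventually_at_right_zero_free:
  assumes "X \<ge> 1" "T \<ge> 0"
  shows "\<forall>\<^sub>F T' in at_right T. \<forall>s. zeta_partial_sum X s = 0 \<longrightarrow> \<not> (T < Im s \<and> Im s \<le> T')"
proof -
  let ?Z = "zeta_partial_sum_zeros X (T + 1)"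
  have "\<forall>\<^sub>F T' in at_right T. \<forall>s\<in>?Z. \<not> (T < Im s \<and> Im s \<le> T')"
  proof (intro eventually_ball_finite finite_zeta_partial_sum_zeros assms(1) ballI)
    fix s
    show "\<forall>\<^sub>F T' in at_right T. \<not> (T < Im s \<and> Im s \<le> T')"
    proof (cases "T < Im s")
      case True
      show ?thesis using eventually_at_right_real[OF True] by eventually_elim auto
    qed simp
  qed
  moreover have "\<forall>\<^sub>F T' in at_right T. T' \<in> {T<..<T + 1}"
    by (rule eventually_at_right_real) simp
  ultimately show ?thesis
    by eventually_elim (use assms(2) in \<open>force simp: zeta_partial_sum_zeros_def\<close>)
qed

lemma weighted_zero_sum_estimate:
  assumes "N \<ge> 1" "U \<ge> real N" "T > 0"
  shows "\<bar>2 * pi * weighted_zero_sum (real N) T U - U * ln (real N) * T\<bar>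
      \<le> 4 * T + pi * (real N + 1) * (U + 2)"
  \<comment> \<open>The line \<open>Im s = T\<close> may contain zeros, but the lines just above it do not.\<close>
proof (rule tendsto_le[OF trivial_limit_at_right_real])
  let ?W = "weighted_zero_sum (real N) T U"
  show "((\<lambda>T'. \<bar>2 * pi * ?W - U * ln (real N) * T'\<bar>) \<longlongrightarrow>
      \<bar>2 * pi * ?W - U * ln (real N) * T\<bar>) (at_right T)"
    "((\<lambda>T'. 4 * T' + pi * (real N + 1) * (U + 2)) \<longlongrightarrow>
      4 * T + pi * (real N + 1) * (U + 2)) (at_right T)"
    by (intro tendsto_intros)+
  have "\<forall>\<^sub>F T' in at_right T. T < T'"
    by (rule eventually_at_right_less)
  moreover have "\<forall>\<^sub>F T' in at_right T. \<forall>s. zeta_partial_sum (real N) s = 0 \<longrightarrow> \<not> (T < Im s \<and> Im s \<le> T')"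
    using assms by (intro eventually_at_right_zero_free) auto
  ultimately show "\<forall>\<^sub>F T' in at_right T.
      \<bar>2 * pi * ?W - U * ln (real N) * T'\<bar> \<le> 4 * T' + pi * (real N + 1) * (U + 2)"
  proof eventually_elim
    case (elim T')
    then have "zeta_partial_sum_zeros (real N) T' = zeta_partial_sum_zeros (real N) T"
      by (force simp: zeta_partial_sum_zeros_def)
    then have "weighted_zero_sum (real N) T' U = ?W" by (simp add: weighted_zero_sum_def)
    then show ?case
      using weighted_zero_sum_estimate_zero_free_top[OF assms(1,2), of T'] elim assms(3) by fastforce
  qed
qed

theorem theorem8:
  shows "\<exists>C\<^sub>1 C\<^sub>2 :: real. \<forall>X T U :: real. 2 \<le> X \<longrightarrow> X \<le> T \<longrightarrow> X \<le> U \<longrightarrow>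
    \<bar>(\<Sum>\<rho>\<in>zeta_partial_sum_zeros X T.
         real_of_int (zorder (zeta_partial_sum X) \<rho>) * (Re \<rho> + U))
       - U * (T / (2 * pi)) * ln (real_of_int \<lfloor>X\<rfloor>)\<bar>
     \<le> C\<^sub>1 * (U * X) + C\<^sub>2 * T"
proof (intro exI allI impI)
  fix X T U :: real
  assume X: "2 \<le> X" and T: "X \<le> T" and U: "X \<le> U"
  define N where "N = nat \<lfloor>X\<rfloor>"
  have N: "N \<ge> 1" "real N \<le> X" "real_of_int \<lfloor>X\<rfloor> = real N"
    using X by (auto simp: N_def le_nat_floor)
  define W where "W = weighted_zero_sum X T U"
  have W: "W = weighted_zero_sum (real N) T U"
    by (simp add: W_def N_def weighted_zero_sum_def zeta_partial_sum_zeros_def flip: zeta_partial_sum_floor)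
  have "2 * pi * \<bar>W - U * (T / (2 * pi)) * ln (real N)\<bar> = \<bar>2 * pi * W - U * ln (real N) * T\<bar>"
    by (simp add: abs_mult_pos' field_simps)
  also have "\<dots> \<le> 4 * T + pi * (real N + 1) * (U + 2)"
    unfolding W using N U X T by (intro weighted_zero_sum_estimate) auto
  also have "\<dots> \<le> 2 * pi * T + pi * (2 * X) * (2 * U)"
    using N U X T pi_gt3 by (intro add_mono mult_mono) auto
  also have "\<dots> = 2 * pi * (2 * (U * X) + 1 * T)" by (simp add: algebra_simps)
  finally show "\<bar>(\<Sum>\<rho>\<in>zeta_partial_sum_zeros X T.
         real_of_int (zorder (zeta_partial_sum X) \<rho>) * (Re \<rho> + U))
       - U * (T / (2 * pi)) * ln (real_of_int \<lfloor>X\<rfloor>)\<bar> \<le> 2 * (U * X) + 1 * T"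
    by (simp add: W_def weighted_zero_sum_def N(3))
qed

end
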